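(* Let $X=(X,\varepsilon(X))$ be an exterior space. Then $X$ is $\check C_0$-complete if and only if the canonical map $e_0\colon L(X)\to\check\pi_0(X)$ is bijective and the following condition holds: for every $x\in L(X)$ and every open subset $U$ of $X$ with $x\in U$, there are $E\in\varepsilon(X)$ and a $q_0$-saturated open subset $W$ in $E$ such that $x\in W\subset U$.
   Context: Exterior spaces: an exterior space is a topological space $X$ together with a nonempty family $\varepsilon(X)$ of open subsets (an externology; its members are called exterior open subsets) closed under finite intersections and such that if $E\in\varepsilon(X)$, $U$ is open and $E\subset U$, then $U\in\varepsilon(X)$. A map between exterior spaces is exterior if it is continuous and preimages of exterior open subsets are exterior open. $\mathbf E$ is the category of exterior spaces and exterior maps. Limit and end spaces: for a space $Y$, $\pi_0(Y)$ is the set of path-components with the quotient topology of $q_0\colon Y\to\pi_0(Y)$. $L(X)=\bigcap_{E\in\varepsilon(X)}E$ (subspace topology); $\check\pi_0(X)=\lim_{E\in\varepsilon(X)}\pi_0(E)$ (inverse limit topology), with projections $\eta_{0,E}\colon\check\pi_0(X)\to\pi_0(E)$; $e_0\colon L(X)\to\check\pi_0(X)$ sends $x$ to the family of path-components of $x$ in the sets $E$. A subset $W\subset E$ ($E\in\varepsilon(X)$) is $q_0$-saturated if it is a union of path-components of $E$, i.e. $q_0^{-1}(q_0(W))=W$ for $q_0\colon E\to\pi_0(E)$. Completion: $\check C_0(X)$ has underlying set the push-out $X\cup_{L(X)}\check\pi_0(X)$ of the inclusion $L(X)\to X$ and $e_0$, with canonical maps $p_0\colon X\to\check C_0(X)$,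 $\operatorname{in}_0\colon\check\pi_0(X)\to\check C_0(X)$. A subset $W$ is open iff (i) $p_0^{-1}(W)$ and $\operatorname{in}_0^{-1}(W)$ are open, and (ii) for each $a\in\operatorname{in}_0^{-1}(W)$ there are $E\in\varepsilon(X)$ and an open $G\subset\pi_0(E)$ with $a\in\eta_{0,E}^{-1}(G)\subset\operatorname{in}_0^{-1}(W)$ and $q_0^{-1}(G)\subset p_0^{-1}(W)$. Its externology is $\{W_0(E): E\in\varepsilon(X)\}$ with $W_0(E)=p_0(E)\cup\operatorname{in}_0(\check\pi_0(X))$. $X$ is $\check C_0$-complete if $p_0\colon X\to\check C_0(X)$ is an isomorphism in $\mathbf E$. *)

theory Defs
  imports "HOL-Analysis.Analysis"
begin

section \<open>Exterior spaces\<close>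

text \<open>Closure under the empty intersection is implied: an externology is nonempty and upward
  closed among open sets, so it contains the whole space.\<close>

definition exterior_space :: "'a topology \<Rightarrow> 'a set set \<Rightarrow> bool" where
  "exterior_space X \<epsilon> \<longleftrightarrow>
     \<epsilon> \<noteq> {} \<and> (\<forall>E\<in>\<epsilon>. openin X E) \<and> (\<forall>E\<in>\<epsilon>. \<forall>F\<in>\<epsilon>. E \<inter> F \<in> \<epsilon>) \<and>
     (\<forall>E\<in>\<epsilon>. \<forall>U. openin X U \<and> E \<subseteq> U \<longrightarrow> U \<in> \<epsilon>)"

definition exterior_map ::
  "'a topology \<Rightarrow> 'a set set \<Rightarrow> 'b topology \<Rightarrow> 'b set set \<Rightarrow> ('a \<Rightarrow> 'b) \<Rightarrow> bool" where
  "exterior_map X \<epsilon> Y \<delta> f \<longleftrightarrow>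
     continuous_map X Y f \<and> (\<forall>E\<in>\<delta>. {x \<in> topspace X. f x \<in> E} \<in> \<epsilon>)"

definition exterior_iso ::
  "'a topology \<Rightarrow> 'a set set \<Rightarrow> 'b topology \<Rightarrow> 'b set set \<Rightarrow> ('a \<Rightarrow> 'b) \<Rightarrow> bool" where
  "exterior_iso X \<epsilon> Y \<delta> f \<longleftrightarrow>
     exterior_map X \<epsilon> Y \<delta> f \<and>
     (\<exists>g. exterior_map Y \<delta> X \<epsilon> g \<and>
          (\<forall>x\<in>topspace X. g (f x) = x) \<and> (\<forall>y\<in>topspace Y. f (g y) = y))"


section \<open>The space of path-components\<close>

definition quotient_topology :: "'a topology \<Rightarrow> ('a \<Rightarrow> 'b) \<Rightarrow> 'b topology" where
  "quotient_topology Y q =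
     topology (\<lambda>G. G \<subseteq> q ` topspace Y \<and> openin Y {x \<in> topspace Y. q x \<in> G})"

definition q0 :: "'a topology \<Rightarrow> 'a \<Rightarrow> 'a set" where
  "q0 Y x = path_component_of_set Y x"

definition pi0 :: "'a topology \<Rightarrow> 'a set topology" where
  "pi0 Y = quotient_topology Y (q0 Y)"

text \<open>The map induced by \<open>f\<close> on path-components, with values in \<open>pi0 Y\<close>; see \<open>pi0_map_q0\<close>
  below for its independence of the chosen representative.\<close>

definition pi0_map :: "'b topology \<Rightarrow> ('a \<Rightarrow> 'b) \<Rightarrow> 'a set \<Rightarrow> 'b set" where
  "pi0_map Y f C = q0 Y (f (SOME x. x \<in> C))"

definition q0_saturated :: "'a topology \<Rightarrow> 'a set \<Rightarrow> bool" where
  "q0_saturated Y W \<longleftrightarrow>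
     W \<subseteq> topspace Y \<and> {x \<in> topspace Y. q0 Y x \<in> q0 Y ` W} = W"


section \<open>Limit space and end space\<close>

definition limit_space :: "'a set set \<Rightarrow> 'a set" where
  "limit_space \<epsilon> = \<Inter>\<epsilon>"

text \<open>A point of the inverse limit is a family of path-components indexed by \<open>\<epsilon>\<close> (extensional
  outside \<open>\<epsilon>\<close>), compatible with the maps induced by the inclusions \<open>F \<subseteq> E\<close>.\<close>

definition end_space :: "'a topology \<Rightarrow> 'a set set \<Rightarrow> ('a set \<Rightarrow> 'a set) topology" where
  "end_space X \<epsilon> =
     subtopology (product_topology (\<lambda>E. pi0 (subtopology X E)) \<epsilon>)
       {a. \<forall>E\<in>\<epsilon>. \<forall>F\<in>\<epsilon>. F \<subseteq> E \<longrightarrow> pi0_map (subtopology X E) (\<lambda>x. x) (a F) = a E}"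

definition eta0 :: "'a set \<Rightarrow> ('a set \<Rightarrow> 'a set) \<Rightarrow> 'a set" where
  "eta0 E a = a E"

definition e0 :: "'a topology \<Rightarrow> 'a set set \<Rightarrow> 'a \<Rightarrow> ('a set \<Rightarrow> 'a set)" where
  "e0 X \<epsilon> x = (\<lambda>E\<in>\<epsilon>. q0 (subtopology X E) x)"


section \<open>Push-outs of sets\<close>

text \<open>The equivalence relation on the disjoint union generated by \<open>i l \<sim> j l\<close>.\<close>

definition pushout_rel ::
  "'a set \<Rightarrow> 'b set \<Rightarrow> 'c set \<Rightarrow> ('c \<Rightarrow> 'a) \<Rightarrow> ('c \<Rightarrow> 'b) \<Rightarrow> (('a + 'b) \<times> ('a + 'b)) set" where
  "pushout_rel A B L i j =
     (let R = {(Inl (i l), Inr (j l)) |l. l \<in> L}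
      in (R \<union> R\<inverse>)\<^sup>* \<inter> (A <+> B) \<times> (A <+> B))"

definition pushout ::
  "'a set \<Rightarrow> 'b set \<Rightarrow> 'c set \<Rightarrow> ('c \<Rightarrow> 'a) \<Rightarrow> ('c \<Rightarrow> 'b) \<Rightarrow> ('a + 'b) set set" where
  "pushout A B L i j = (A <+> B) // pushout_rel A B L i j"


section \<open>The completion\<close>

abbreviation C0_rel where
  "C0_rel X \<epsilon> \<equiv>
     pushout_rel (topspace X) (topspace (end_space X \<epsilon>)) (limit_space \<epsilon>) (\<lambda>x. x) (e0 X \<epsilon>)"

definition C0_set :: "'a topology \<Rightarrow> 'a set set \<Rightarrow> ('a + ('a set \<Rightarrow> 'a set)) set set" where
  "C0_set X \<epsilon> =
     pushout (topspace X) (topspace (end_space X \<epsilon>)) (limit_space \<epsilon>) (\<lambda>x. x) (e0 X \<epsilon>)"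

definition p0 :: "'a topology \<Rightarrow> 'a set set \<Rightarrow> 'a \<Rightarrow> ('a + ('a set \<Rightarrow> 'a set)) set" where
  "p0 X \<epsilon> x = C0_rel X \<epsilon> `` {Inl x}"

definition in0 ::
  "'a topology \<Rightarrow> 'a set set \<Rightarrow> ('a set \<Rightarrow> 'a set) \<Rightarrow> ('a + ('a set \<Rightarrow> 'a set)) set" where
  "in0 X \<epsilon> a = C0_rel X \<epsilon> `` {Inr a}"

definition C0_open :: "'a topology \<Rightarrow> 'a set set \<Rightarrow> ('a + ('a set \<Rightarrow> 'a set)) set set \<Rightarrow> bool" where
  "C0_open X \<epsilon> W \<longleftrightarrow>
     W \<subseteq> C0_set X \<epsilon> \<and>
     (let P = {x \<in> topspace X. p0 X \<epsilon> x \<in> W};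
          A = {a \<in> topspace (end_space X \<epsilon>). in0 X \<epsilon> a \<in> W}
      in openin X P \<and> openin (end_space X \<epsilon>) A \<and>
         (\<forall>a\<in>A. \<exists>E\<in>\<epsilon>. \<exists>G. openin (pi0 (subtopology X E)) G \<and>
            eta0 E a \<in> G \<and>
            {b \<in> topspace (end_space X \<epsilon>). eta0 E b \<in> G} \<subseteq> A \<and>
            {x \<in> E. q0 (subtopology X E) x \<in> G} \<subseteq> P))"

definition C0_space ::
  "'a topology \<Rightarrow> 'a set set \<Rightarrow> ('a + ('a set \<Rightarrow> 'a set)) set topology" where
  "C0_space X \<epsilon> = topology (C0_open X \<epsilon>)"

definition W0 ::
  "'a topology \<Rightarrow> 'a set set \<Rightarrow> 'a set \<Rightarrow> ('a + ('a set \<Rightarrow> 'a set)) set set" where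
  "W0 X \<epsilon> E = p0 X \<epsilon> ` E \<union> in0 X \<epsilon> ` topspace (end_space X \<epsilon>)"

definition C0_externology ::
  "'a topology \<Rightarrow> 'a set set \<Rightarrow> ('a + ('a set \<Rightarrow> 'a set)) set set set" where
  "C0_externology X \<epsilon> = W0 X \<epsilon> ` \<epsilon>"

definition C0_complete :: "'a topology \<Rightarrow> 'a set set \<Rightarrow> bool" where
  "C0_complete X \<epsilon> \<longleftrightarrow>
     exterior_iso X \<epsilon> (C0_space X \<epsilon>) (C0_externology X \<epsilon>) (p0 X \<epsilon>)"


section \<open>Well-definedness\<close>

lemma openin_quotient_topology:
  "openin (quotient_topology Y q) G \<longleftrightarrow>
     G \<subseteq> q ` topspace Y \<and> openin Y {x \<in> topspace Y. q x \<in> G}"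
proof -
  have "istopology (\<lambda>G. G \<subseteq> q ` topspace Y \<and> openin Y {x \<in> topspace Y. q x \<in> G})"
    unfolding istopology_def
  proof (intro conjI allI impI)
    fix S T
    assume S: "S \<subseteq> q ` topspace Y \<and> openin Y {x \<in> topspace Y. q x \<in> S}"
      and T: "T \<subseteq> q ` topspace Y \<and> openin Y {x \<in> topspace Y. q x \<in> T}"
    show "S \<inter> T \<subseteq> q ` topspace Y" using S by blast
    have "{x \<in> topspace Y. q x \<in> S \<inter> T} = {x \<in> topspace Y. q x \<in> S} \<inter> {x \<in> topspace Y. q x \<in> T}"
      by blast
    then show "openin Y {x \<in> topspace Y. q x \<in> S \<inter> T}" using S T by auto
  next
    fix K
    assume K: "\<forall>S\<in>K. S \<subseteq> q ` topspace Y \<and> openin Y {x \<in> topspace Y. q x \<in> S}"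
    show "\<Union>K \<subseteq> q ` topspace Y" using K by blast
    have "{x \<in> topspace Y. q x \<in> \<Union>K} = (\<Union>S\<in>K. {x \<in> topspace Y. q x \<in> S})" by blast
    then show "openin Y {x \<in> topspace Y. q x \<in> \<Union>K}" using K by auto
  qed
  then show ?thesis
    unfolding quotient_topology_def by (simp add: topology_inverse')
qed

lemma topspace_quotient_topology: "topspace (quotient_topology Y q) = q ` topspace Y"
proof
  show "topspace (quotient_topology Y q) \<subseteq> q ` topspace Y"
    using openin_quotient_topology[of Y q] by (metis openin_topspace)
  have "{x \<in> topspace Y. q x \<in> q ` topspace Y} = topspace Y" by blast
  then have "openin (quotient_topology Y q) (q ` topspace Y)"
    by (simp add: openin_quotient_topology)
  then show "q ` topspace Y \<subseteq> topspace (quotient_topology Y q)" by (rule openin_subset)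
qed

lemma quotient_map_quotient_topology: "quotient_map Y (quotient_topology Y q) q"
  unfolding quotient_map_def topspace_quotient_topology
  by (auto simp: openin_quotient_topology)

lemma topspace_pi0: "topspace (pi0 Y) = path_components_of Y"
  by (simp add: pi0_def topspace_quotient_topology path_components_of_def q0_def)

lemma q0_eq_iff:
  assumes "x \<in> topspace Y" "y \<in> topspace Y"
  shows "q0 Y x = q0 Y y \<longleftrightarrow> path_component_of Y x y"
  using assms unfolding q0_def
  by (metis Collect_inj path_component_of_equiv)

lemma pi0_map_q0:
  assumes "continuous_map X Y f" "x \<in> topspace X"
  shows "pi0_map Y f (q0 X x) = q0 Y (f x)"
proof -
  have "x \<in> q0 X x" using assms by (simp add: q0_def path_component_of_refl)
  then have "(SOME y. y \<in> q0 X x) \<in> q0 X x" by (rule someI)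
  then have "path_component_of X x (SOME y. y \<in> q0 X x)" by (simp add: q0_def)
  then obtain g where g: "pathin X g" "g 0 = x" "g 1 = (SOME y. y \<in> q0 X x)"
    by (auto simp: path_component_of_def)
  have "pathin Y (f \<circ> g)" using g(1) assms(1) unfolding pathin_def
    by (rule continuous_map_compose)
  then have p: "path_component_of Y (f x) (f (SOME y. y \<in> q0 X x))"
    unfolding path_component_of_def using g(2,3) by (intro exI[of _ "f \<circ> g"]) auto
  then have "f x \<in> topspace Y" "f (SOME y. y \<in> q0 X x) \<in> topspace Y"
    by (auto dest: path_component_in_topspace)
  then show ?thesis using p unfolding pi0_map_def by (metis q0_eq_iff)
qed

lemma
  assumes "exterior_space X \<epsilon>"
  shows exterior_nonempty: "\<epsilon> \<noteq> {}"
    and exterior_openin: "E \<in> \<epsilon> \<Longrightarrow> openin X E"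
    and exterior_Int: "E \<in> \<epsilon> \<Longrightarrow> F \<in> \<epsilon> \<Longrightarrow> E \<inter> F \<in> \<epsilon>"
    and exterior_upward: "E \<in> \<epsilon> \<Longrightarrow> openin X U \<Longrightarrow> E \<subseteq> U \<Longrightarrow> U \<in> \<epsilon>"
  using assms unfolding exterior_space_def by blast+

lemma topspace_exterior_subtopology:
  assumes "exterior_space X \<epsilon>" "E \<in> \<epsilon>"
  shows "topspace (subtopology X E) = E"
  using openin_subset[OF exterior_openin[OF assms]] by (auto simp: topspace_subtopology)

lemma e0_in_end_space:
  assumes "exterior_space X \<epsilon>" "x \<in> limit_space \<epsilon>"
  shows "e0 X \<epsilon> x \<in> topspace (end_space X \<epsilon>)"
proof -
  have top: "topspace (subtopology X E) = E" if "E \<in> \<epsilon>" for E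
    using assms(1) that by (rule topspace_exterior_subtopology)
  have xE: "x \<in> E" if "E \<in> \<epsilon>" for E using assms(2) that by (auto simp: limit_space_def)
  have "pi0_map (subtopology X E) (\<lambda>x. x) (q0 (subtopology X F) x) = q0 (subtopology X E) x"
    if "E \<in> \<epsilon>" "F \<in> \<epsilon>" "F \<subseteq> E" for E F
  proof (rule pi0_map_q0)
    have "continuous_map (subtopology X F) X (\<lambda>x. x)"
      by (simp add: continuous_map_from_subtopology)
    then show "continuous_map (subtopology X F) (subtopology X E) (\<lambda>x. x)"
      using that top[of F] by (auto simp: continuous_map_in_subtopology)
    show "x \<in> topspace (subtopology X F)" using top xE that by simp
  qed
  moreover have "e0 X \<epsilon> x \<in> (\<Pi>\<^sub>E E\<in>\<epsilon>. topspace (pi0 (subtopology X E)))"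
    unfolding e0_def pi0_def topspace_quotient_topology using top xE by auto
  ultimately show ?thesis
    unfolding end_space_def topspace_subtopology topspace_product_topology
    by (simp add: e0_def)
qed

lemma equiv_pushout_rel:
  fixes A :: "'a set" and B :: "'b set"
  shows "equiv (A <+> B) (pushout_rel A B L i j)"
proof -
  define R :: "(('a + 'b) \<times> ('a + 'b)) set" where "R = {(Inl (i l), Inr (j l)) |l. l \<in> L}"
  have "sym ((R \<union> R\<inverse>)\<^sup>*)" by (intro sym_rtrancl sym_Un_converse)
  moreover have "trans ((R \<union> R\<inverse>)\<^sup>*)" by (rule trans_rtrancl)
  ultimately show ?thesis
    unfolding pushout_rel_def R_def[symmetric] Let_def
    by (intro equivI refl_onI symI transI) (blast dest: symD transD)+
qed

lemma eta0_in_pi0: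
  assumes "a \<in> topspace (end_space X \<epsilon>)" "E \<in> \<epsilon>"
  shows "eta0 E a \<in> topspace (pi0 (subtopology X E))"
  using assms by (auto simp: end_space_def eta0_def)

lemma end_space_bond:
  assumes "a \<in> topspace (end_space X \<epsilon>)" "exterior_space X \<epsilon>" "E \<in> \<epsilon>" "F \<in> \<epsilon>" "F \<subseteq> E"
    "x \<in> F" "eta0 F a = q0 (subtopology X F) x"
  shows "eta0 E a = q0 (subtopology X E) x"
proof -
  have F: "topspace (subtopology X F) = F"
    using assms(2,4) by (rule topspace_exterior_subtopology)
  have "continuous_map (subtopology X F) X (\<lambda>x. x)"
    by (simp add: continuous_map_from_subtopology)
  then have "continuous_map (subtopology X F) (subtopology X E) (\<lambda>x. x)"
    using assms(5) F by (auto simp: continuous_map_in_subtopology)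
  then have "pi0_map (subtopology X E) (\<lambda>x. x) (q0 (subtopology X F) x) = q0 (subtopology X E) x"
    using F assms(6) by (intro pi0_map_q0) auto
  moreover have "pi0_map (subtopology X E) (\<lambda>x. x) (a F) = a E"
    using assms(1,3,4,5) by (simp add: end_space_def)
  ultimately show ?thesis using assms(7) by (simp add: eta0_def)
qed

lemma istopology_C0_open:
  assumes ext: "exterior_space X \<epsilon>"
  shows "istopology (C0_open X \<epsilon>)"
  unfolding istopology_def
proof (intro conjI allI impI)
  fix S T
  assume S: "C0_open X \<epsilon> S" and T: "C0_open X \<epsilon> T"
  define P where "P W = {x \<in> topspace X. p0 X \<epsilon> x \<in> W}" for W
  define A where "A W = {a \<in> topspace (end_space X \<epsilon>). in0 X \<epsilon> a \<in> W}" for W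
  have PI: "P (S \<inter> T) = P S \<inter> P T" and AI: "A (S \<inter> T) = A S \<inter> A T"
    by (auto simp: P_def A_def)
  have S': "S \<subseteq> C0_set X \<epsilon> \<and> openin X (P S) \<and> openin (end_space X \<epsilon>) (A S) \<and>
         (\<forall>a\<in>A S. \<exists>E\<in>\<epsilon>. \<exists>G. openin (pi0 (subtopology X E)) G \<and> eta0 E a \<in> G \<and>
            {b \<in> topspace (end_space X \<epsilon>). eta0 E b \<in> G} \<subseteq> A S \<and>
            {x \<in> E. q0 (subtopology X E) x \<in> G} \<subseteq> P S)"
    using S unfolding C0_open_def Let_def P_def A_def .
  have T': "T \<subseteq> C0_set X \<epsilon> \<and> openin X (P T) \<and> openin (end_space X \<epsilon>) (A T) \<and>
         (\<forall>a\<in>A T. \<exists>E\<in>\<epsilon>. \<exists>G. openin (pi0 (subtopology X E)) G \<and> eta0 E a \<in> G \<and>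
            {b \<in> topspace (end_space X \<epsilon>). eta0 E b \<in> G} \<subseteq> A T \<and>
            {x \<in> E. q0 (subtopology X E) x \<in> G} \<subseteq> P T)"
    using T unfolding C0_open_def Let_def P_def A_def .
  have o: "openin X (P S)" "openin X (P T)" "openin (end_space X \<epsilon>) (A S)"
    "openin (end_space X \<epsilon>) (A T)" "S \<subseteq> C0_set X \<epsilon>"
    using S' T' by simp_all
  have "\<exists>E\<in>\<epsilon>. \<exists>G. openin (pi0 (subtopology X E)) G \<and> eta0 E a \<in> G \<and>
          {b \<in> topspace (end_space X \<epsilon>). eta0 E b \<in> G} \<subseteq> A (S \<inter> T) \<and>
          {x \<in> E. q0 (subtopology X E) x \<in> G} \<subseteq> P (S \<inter> T)"
    if a: "a \<in> A (S \<inter> T)" for a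
  proof -
    obtain E1 G1 where 1: "E1 \<in> \<epsilon>" "openin (pi0 (subtopology X E1)) G1" "eta0 E1 a \<in> G1"
      "{b \<in> topspace (end_space X \<epsilon>). eta0 E1 b \<in> G1} \<subseteq> A S"
      "{x \<in> E1. q0 (subtopology X E1) x \<in> G1} \<subseteq> P S"
      using S' a unfolding AI by (meson IntD1 IntD2)
    obtain E2 G2 where 2: "E2 \<in> \<epsilon>" "openin (pi0 (subtopology X E2)) G2" "eta0 E2 a \<in> G2"
      "{b \<in> topspace (end_space X \<epsilon>). eta0 E2 b \<in> G2} \<subseteq> A T"
      "{x \<in> E2. q0 (subtopology X E2) x \<in> G2} \<subseteq> P T"
      using T' a unfolding AI by (meson IntD1 IntD2)
    define E where "E = E1 \<inter> E2"
    have E: "E \<in> \<epsilon>" using exterior_Int[OF ext 1(1) 2(1)] by (simp add: E_def)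
    have top: "topspace (subtopology X F) = F" if "F \<in> \<epsilon>" for F
      using ext that by (rule topspace_exterior_subtopology)
    define H where "H = {x \<in> E. q0 (subtopology X E1) x \<in> G1 \<and> q0 (subtopology X E2) x \<in> G2}"
    define G where "G = q0 (subtopology X E) ` H"
    have opn: "openin X {x \<in> F. q0 (subtopology X F) x \<in> G'}"
      if "F \<in> \<epsilon>" "openin (pi0 (subtopology X F)) G'" for F G'
    proof -
      have "openin (subtopology X F) {x \<in> F. q0 (subtopology X F) x \<in> G'}"
        using that(2) unfolding pi0_def openin_quotient_topology top[OF that(1)] by blast
      then show ?thesis using exterior_openin[OF ext that(1)] by (rule openin_trans_full)
    qed
    have HX: "openin X H"
    proof -
      have "H = {x \<in> E1. q0 (subtopology X E1) x \<in> G1} \<inter> {x \<in> E2. q0 (subtopology X E2) x \<in> G2}"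
        by (auto simp: H_def E_def)
      then show ?thesis using opn[OF 1(1,2)] opn[OF 2(1,2)] by (simp add: openin_Int)
    qed
    have cm: "pi0_map (subtopology X F) (\<lambda>x. x) (q0 (subtopology X E) x) = q0 (subtopology X F) x"
      if "E \<subseteq> F" "x \<in> E" for F x
    proof (rule pi0_map_q0)
      have "continuous_map (subtopology X E) X (\<lambda>x. x)"
        by (simp add: continuous_map_from_subtopology)
      then show "continuous_map (subtopology X E) (subtopology X F) (\<lambda>x. x)"
        using that top[OF E] by (auto simp: continuous_map_in_subtopology)
      show "x \<in> topspace (subtopology X E)" using top[OF E] that by simp
    qed
    have sat: "{x \<in> E. q0 (subtopology X E) x \<in> G} = H"
    proof
      show "H \<subseteq> {x \<in> E. q0 (subtopology X E) x \<in> G}" by (auto simp: G_def H_def)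
      show "{x \<in> E. q0 (subtopology X E) x \<in> G} \<subseteq> H"
      proof
        fix x assume x: "x \<in> {x \<in> E. q0 (subtopology X E) x \<in> G}"
        then obtain y where y: "y \<in> H" "q0 (subtopology X E) x = q0 (subtopology X E) y"
          by (auto simp: G_def)
        have "x \<in> E" "y \<in> E" using x y(1) by (simp_all add: H_def)
        moreover have "E \<subseteq> E1" "E \<subseteq> E2" by (auto simp: E_def)
        ultimately have "q0 (subtopology X E1) x = q0 (subtopology X E1) y"
            "q0 (subtopology X E2) x = q0 (subtopology X E2) y"
          using cm[of E1 x] cm[of E1 y] cm[of E2 x] cm[of E2 y] y(2) by simp_all
        then show "x \<in> H" using y x by (simp add: H_def)
      qed
    qed
    have "openin (pi0 (subtopology X E)) G"
      unfolding pi0_def openin_quotient_topology top[OF E] sat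
    proof
      show "G \<subseteq> q0 (subtopology X E) ` E" unfolding G_def by (rule image_mono) (simp add: H_def)
      show "openin (subtopology X E) H"
        using HX by (rule subset_openin_subtopology) (simp add: H_def)
    qed
    moreover have inG: "eta0 E b \<in> G \<longleftrightarrow> eta0 E1 b \<in> G1 \<and> eta0 E2 b \<in> G2"
      if b: "b \<in> topspace (end_space X \<epsilon>)" for b
    proof -
      obtain x where x: "x \<in> E" "eta0 E b = q0 (subtopology X E) x"
        using eta0_in_pi0[OF b E] top[OF E] by (auto simp: pi0_def topspace_quotient_topology)
      then have "eta0 E1 b = q0 (subtopology X E1) x" "eta0 E2 b = q0 (subtopology X E2) x"
        using end_space_bond[OF b ext _ E] 1(1) 2(1) by (auto simp: E_def)
      moreover have "eta0 E b \<in> G \<longleftrightarrow> x \<in> H" using sat x by auto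
      ultimately show ?thesis using x by (simp add: H_def)
    qed
    moreover have "a \<in> topspace (end_space X \<epsilon>)" using a by (simp add: A_def)
    moreover have "{b \<in> topspace (end_space X \<epsilon>). eta0 E b \<in> G} \<subseteq> A (S \<inter> T)"
      using inG 1(4) 2(4) unfolding AI by blast
    moreover have "{x \<in> E. q0 (subtopology X E) x \<in> G} \<subseteq> P (S \<inter> T)"
      unfolding sat PI using 1(5) 2(5) by (auto simp: H_def E_def)
    ultimately show ?thesis using E 1(3) 2(3) by blast
  qed
  then show "C0_open X \<epsilon> (S \<inter> T)"
    using o PI AI unfolding C0_open_def Let_def P_def[symmetric] A_def[symmetric] by auto
next
  fix K
  assume K: "\<forall>W\<in>K. C0_open X \<epsilon> W"
  define P where "P W = {x \<in> topspace X. p0 X \<epsilon> x \<in> W}" for W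
  define A where "A W = {a \<in> topspace (end_space X \<epsilon>). in0 X \<epsilon> a \<in> W}" for W
  have PU: "P (\<Union>K) = (\<Union>W\<in>K. P W)" and AU: "A (\<Union>K) = (\<Union>W\<in>K. A W)"
    by (auto simp: P_def A_def)
  have K': "\<forall>W\<in>K. W \<subseteq> C0_set X \<epsilon> \<and> openin X (P W) \<and> openin (end_space X \<epsilon>) (A W) \<and>
         (\<forall>a\<in>A W. \<exists>E\<in>\<epsilon>. \<exists>G. openin (pi0 (subtopology X E)) G \<and> eta0 E a \<in> G \<and>
            {b \<in> topspace (end_space X \<epsilon>). eta0 E b \<in> G} \<subseteq> A W \<and>
            {x \<in> E. q0 (subtopology X E) x \<in> G} \<subseteq> P W)"
    using K unfolding C0_open_def Let_def P_def A_def .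
  have "\<exists>E\<in>\<epsilon>. \<exists>G. openin (pi0 (subtopology X E)) G \<and> eta0 E a \<in> G \<and>
            {b \<in> topspace (end_space X \<epsilon>). eta0 E b \<in> G} \<subseteq> A (\<Union>K) \<and>
            {x \<in> E. q0 (subtopology X E) x \<in> G} \<subseteq> P (\<Union>K)" if a: "a \<in> A (\<Union>K)" for a
  proof -
    obtain W where "W \<in> K" "a \<in> A W" using a AU by auto
    then obtain E G where "E \<in> \<epsilon>" "openin (pi0 (subtopology X E)) G" "eta0 E a \<in> G"
        "{b \<in> topspace (end_space X \<epsilon>). eta0 E b \<in> G} \<subseteq> A W"
        "{x \<in> E. q0 (subtopology X E) x \<in> G} \<subseteq> P W" using K' by meson
    moreover have "A W \<subseteq> A (\<Union>K)" "P W \<subseteq> P (\<Union>K)" using \<open>W \<in> K\<close> by (auto simp: AU PU)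
    ultimately show ?thesis by (meson subset_trans)
  qed
  moreover have "\<Union>K \<subseteq> C0_set X \<epsilon>" "openin X (P (\<Union>K))" "openin (end_space X \<epsilon>) (A (\<Union>K))"
    using K' unfolding PU AU by auto
  ultimately show "C0_open X \<epsilon> (\<Union>K)"
    unfolding C0_open_def Let_def P_def[symmetric] A_def[symmetric] by blast
qed

lemma openin_C0_space:
  "exterior_space X \<epsilon> \<Longrightarrow> openin (C0_space X \<epsilon>) W \<longleftrightarrow> C0_open X \<epsilon> W"
  unfolding C0_space_def by (simp add: istopology_C0_open topology_inverse')

lemma p0_in_C0_set: "x \<in> topspace X \<Longrightarrow> p0 X \<epsilon> x \<in> C0_set X \<epsilon>"
  unfolding p0_def C0_set_def pushout_def by (auto intro: quotientI)

lemma in0_in_C0_set: "a \<in> topspace (end_space X \<epsilon>) \<Longrightarrow> in0 X \<epsilon> a \<in> C0_set X \<epsilon>"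
  unfolding in0_def C0_set_def pushout_def by (auto intro: quotientI)

lemma C0_set_eq:
  "C0_set X \<epsilon> = p0 X \<epsilon> ` topspace X \<union> in0 X \<epsilon> ` topspace (end_space X \<epsilon>)"
  unfolding C0_set_def pushout_def p0_def in0_def quotient_def Plus_def
  by (simp add: UN_Un image_Un image_image UNION_singleton_eq_range)

lemma p0_eq_in0:
  assumes "exterior_space X \<epsilon>" "x \<in> limit_space \<epsilon>"
  shows "p0 X \<epsilon> x = in0 X \<epsilon> (e0 X \<epsilon> x)"
proof -
  have "x \<in> topspace X"
    using assms(2) exterior_nonempty[OF assms(1)] openin_subset[OF exterior_openin[OF assms(1)]]
    by (auto simp: limit_space_def)
  then have "(Inl x, Inr (e0 X \<epsilon> x)) \<in> C0_rel X \<epsilon>"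
    using assms e0_in_end_space[OF assms] unfolding pushout_rel_def Let_def by auto
  then show ?thesis unfolding p0_def in0_def by (rule equiv_class_eq[OF equiv_pushout_rel])
qed

lemma pushout_rel_Inl:
  fixes X :: "'a topology"
  assumes "(Inl x, v) \<in> C0_rel X \<epsilon>" "x \<notin> limit_space \<epsilon>"
  shows "v = Inl x"
proof -
  let ?R = "{(Inl l, Inr (e0 X \<epsilon> l)) |l. l \<in> limit_space \<epsilon>}
    :: (('a + ('a set \<Rightarrow> 'a set)) \<times> ('a + ('a set \<Rightarrow> 'a set))) set"
  have "(Inl x, v) \<in> (?R \<union> ?R\<inverse>)\<^sup>*" using assms(1) unfolding pushout_rel_def Let_def by (rule IntD1)
  then show ?thesis
  proof (induction rule: rtrancl_induct)
    case (step u w)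
    then show ?case using assms(2) by blast
  qed simp
qed

lemma p0_in_W0_iff:
  fixes X :: "'a topology"
  assumes ext: "exterior_space X \<epsilon>" and "E \<in> \<epsilon>" "x \<in> topspace X"
  shows "p0 X \<epsilon> x \<in> W0 X \<epsilon> E \<longleftrightarrow> x \<in> E"
proof
  assume w: "p0 X \<epsilon> x \<in> W0 X \<epsilon> E"
  show "x \<in> E"
  proof (cases "x \<in> limit_space \<epsilon>")
    case True
    then show ?thesis using assms by (auto simp: limit_space_def)
  next
    case False
    have cls: "v = Inl x" if "C0_rel X \<epsilon> `` {Inl x} = C0_rel X \<epsilon> `` {v}"
        "v \<in> topspace X <+> topspace (end_space X \<epsilon>)" for v
    proof (rule pushout_rel_Inl[OF _ False])
      have "v \<in> C0_rel X \<epsilon> `` {v}" by (rule equiv_class_self[OF equiv_pushout_rel that(2)])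
      then show "(Inl x, v) \<in> C0_rel X \<epsilon>" unfolding that(1)[symmetric] by (rule ImageE) simp
    qed
    have EX: "E \<subseteq> topspace X" by (rule openin_subset[OF exterior_openin[OF ext assms(2)]])
    from w consider y where "y \<in> E" "p0 X \<epsilon> x = p0 X \<epsilon> y"
      | a where "a \<in> topspace (end_space X \<epsilon>)" "p0 X \<epsilon> x = in0 X \<epsilon> a"
      unfolding W0_def by blast
    then show ?thesis
    proof cases
      case 1
      then have "Inl y = (Inl x :: 'a + ('a set \<Rightarrow> 'a set))"
        using EX by (intro cls) (auto simp: p0_def)
      then show ?thesis using 1 by simp
    next
      case 2
      then have "Inr a = (Inl x :: 'a + ('a set \<Rightarrow> 'a set))"
        by (intro cls) (auto simp: p0_def in0_def)
      then show ?thesis by simp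
    qed
  qed
qed (simp add: W0_def)

lemma exterior_space_C0:
  assumes ext: "exterior_space X \<epsilon>"
  shows "exterior_space (C0_space X \<epsilon>) (C0_externology X \<epsilon>)"
proof -
  let ?W = "W0 X \<epsilon>"
  have sub: "E \<subseteq> topspace X" if "E \<in> \<epsilon>" for E
    by (rule openin_subset[OF exterior_openin[OF ext that]])
  have P: "{x \<in> topspace X. p0 X \<epsilon> x \<in> ?W E} = E" if "E \<in> \<epsilon>" for E
    using p0_in_W0_iff[OF ext that] sub[OF that] by blast
  have A: "{a \<in> topspace (end_space X \<epsilon>). in0 X \<epsilon> a \<in> ?W E} = topspace (end_space X \<epsilon>)" for E
    by (auto simp: W0_def)
  have WC: "?W E \<subseteq> C0_set X \<epsilon>" if "E \<in> \<epsilon>" for E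
    using sub[OF that] by (auto simp: W0_def C0_set_eq)
  have "C0_open X \<epsilon> (?W E)" if E: "E \<in> \<epsilon>" for E
    unfolding C0_open_def Let_def P[OF E] A
  proof (intro conjI ballI)
    fix a assume a: "a \<in> topspace (end_space X \<epsilon>)"
    show "\<exists>F\<in>\<epsilon>. \<exists>G. openin (pi0 (subtopology X F)) G \<and> eta0 F a \<in> G \<and>
        {b \<in> topspace (end_space X \<epsilon>). eta0 F b \<in> G} \<subseteq> topspace (end_space X \<epsilon>) \<and>
        {x \<in> F. q0 (subtopology X F) x \<in> G} \<subseteq> E"
      using E eta0_in_pi0[OF a E]
      by (intro bexI[of _ E] exI[of _ "topspace (pi0 (subtopology X E))"]) auto
  qed (use WC[OF E] exterior_openin[OF ext E] in simp_all)
  moreover have "?W E \<inter> ?W F = ?W (E \<inter> F)" if "E \<in> \<epsilon>" "F \<in> \<epsilon>" for E F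
  proof
    show "?W E \<inter> ?W F \<subseteq> ?W (E \<inter> F)"
    proof
      fix w assume w: "w \<in> ?W E \<inter> ?W F"
      show "w \<in> ?W (E \<inter> F)"
      proof (cases "w \<in> in0 X \<epsilon> ` topspace (end_space X \<epsilon>)")
        case False
        then obtain x where "x \<in> E" "w = p0 X \<epsilon> x" using w by (auto simp: W0_def)
        moreover have "p0 X \<epsilon> x \<in> ?W F" using w \<open>w = _\<close> by simp
        ultimately have "x \<in> E \<inter> F" using p0_in_W0_iff[OF ext that(2), of x] sub[OF that(1)] by auto
        then show ?thesis using \<open>w = _\<close> by (simp add: W0_def)
      qed (simp add: W0_def)
    qed
  qed (auto simp: W0_def)
  moreover have "U \<in> ?W ` \<epsilon>" if E: "E \<in> \<epsilon>" and U: "C0_open X \<epsilon> U" "?W E \<subseteq> U" for E U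
  proof -
    let ?F = "{x \<in> topspace X. p0 X \<epsilon> x \<in> U}"
    have "openin X ?F" "E \<subseteq> ?F" using U sub[OF E] by (auto simp: C0_open_def Let_def W0_def)
    then have "?F \<in> \<epsilon>" by (rule exterior_upward[OF ext E])
    moreover have "U = ?W ?F"
      using U unfolding C0_open_def C0_set_eq W0_def by blast
    ultimately show ?thesis by blast
  qed
  ultimately show ?thesis
    using ext unfolding exterior_space_def[of "C0_space X \<epsilon>"] C0_externology_def
      openin_C0_space[OF ext]
    by (auto simp: exterior_nonempty[OF ext] exterior_Int[OF ext])
qed

lemma topspace_C0_space:
  assumes ext: "exterior_space X \<epsilon>"
  shows "topspace (C0_space X \<epsilon>) = C0_set X \<epsilon>"
proof
  show "topspace (C0_space X \<epsilon>) \<subseteq> C0_set X \<epsilon>"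
    using openin_C0_space[OF ext] by (metis C0_open_def openin_topspace)
  obtain E where E: "E \<in> \<epsilon>" using exterior_nonempty[OF ext] by blast
  then have "topspace X \<in> \<epsilon>"
    by (rule exterior_upward[OF ext]) (use openin_subset[OF exterior_openin[OF ext E]] in auto)
  then have "W0 X \<epsilon> (topspace X) \<in> C0_externology X \<epsilon>" by (simp add: C0_externology_def)
  then have "openin (C0_space X \<epsilon>) (W0 X \<epsilon> (topspace X))"
    using exterior_space_C0[OF ext] by (simp add: exterior_space_def)
  then show "C0_set X \<epsilon> \<subseteq> topspace (C0_space X \<epsilon>)"
    by (auto simp: W0_def C0_set_eq dest: openin_subset)
qed

end

theory Submission
  imports Defs
begin

text \<open>Completeness asks the map \<open>p0\<close> to have an exterior inverse. Whether \<open>p0\<close> has any inverse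
  is a matter of sets: in the push-out, gluing happens only along \<open>e0\<close>, so \<open>p0\<close> identifies two
  points exactly when they lie in the limit space and \<open>e0\<close> identifies them, and it misses exactly
  the ends outside the range of \<open>e0\<close>. Hence \<open>p0\<close> is bijective iff \<open>e0\<close> is
  (\<open>bij_betw_p0_iff\<close>).

  Suppose now that both are bijective. The map \<open>p0\<close> is always exterior, and its inverse respects
  the externologies for free, because every end is already represented by a point of the limit
  space, so that \<open>W0 X \<epsilon> E\<close> is just the image of \<open>E\<close>. What remains is continuity of the inverse:
  for open \<open>U\<close> the image of \<open>U\<close> under \<open>p0\<close> must be open in the completion. Its trace on \<open>X\<close> is
  \<open>U\<close>, and the ends in it are those of points of the limit space in \<open>U\<close>. So the requirement at
  such an end is that some open set of path-components of an exterior set contains the component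
  of the point and has its union inside \<open>U\<close>. Open sets of path-components of \<open>E\<close> correspond to
  \<open>q0\<close>-saturated open subsets of \<open>E\<close>, and this makes the requirement the local condition of the
  theorem (\<open>C0_open_p0_image_iff\<close>).\<close>

section \<open>Gluing in the push-out\<close>

text \<open>Because the inclusion of the limit space is injective, an end is only ever glued to the
  limit points that \<open>e0\<close> sends to it: a zigzag starting at an end cannot reach another end.\<close>

lemma pushout_rel_Inr:
  fixes X :: "'a topology"
  assumes "(Inr a, v) \<in> C0_rel X \<epsilon>"
  shows "v = Inr a \<or> (\<exists>l\<in>limit_space \<epsilon>. v = Inl l \<and> e0 X \<epsilon> l = a)"
proof -
  let ?R = "{(Inl l, Inr (e0 X \<epsilon> l)) |l. l \<in> limit_space \<epsilon>}
    :: (('a + ('a set \<Rightarrow> 'a set)) \<times> ('a + ('a set \<Rightarrow> 'a set))) set"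
  have "(Inr a, v) \<in> (?R \<union> ?R\<inverse>)\<^sup>*"
    using assms unfolding pushout_rel_def Let_def by (rule IntD1)
  then show ?thesis
    by (induction rule: rtrancl_induct) auto
qed

lemma limit_space_subset_topspace:
  assumes "exterior_space X \<epsilon>"
  shows "limit_space \<epsilon> \<subseteq> topspace X"
  using exterior_nonempty[OF assms] openin_subset[OF exterior_openin[OF assms]]
  by (auto simp: limit_space_def)

lemma in0_eq_p0_iff:
  assumes ext: "exterior_space X \<epsilon>"
    and "a \<in> topspace (end_space X \<epsilon>)" "x \<in> topspace X"
  shows "in0 X \<epsilon> a = p0 X \<epsilon> x \<longleftrightarrow> x \<in> limit_space \<epsilon> \<and> e0 X \<epsilon> x = a"
proof
  assume "in0 X \<epsilon> a = p0 X \<epsilon> x"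
  then have "(Inr a, Inl x) \<in> C0_rel X \<epsilon>"
    unfolding in0_def p0_def
    by (rule eq_equiv_class[OF _ equiv_pushout_rel]) (use assms in auto)
  then show "x \<in> limit_space \<epsilon> \<and> e0 X \<epsilon> x = a"
    using pushout_rel_Inr by blast
next
  assume "x \<in> limit_space \<epsilon> \<and> e0 X \<epsilon> x = a"
  then show "in0 X \<epsilon> a = p0 X \<epsilon> x"
    using p0_eq_in0[OF ext] by auto
qed

text \<open>A point off the limit space is glued to nothing, and two limit points are glued only
  through their common end.\<close>

lemma p0_eq_p0_iff:
  assumes ext: "exterior_space X \<epsilon>"
    and x: "x \<in> topspace X" and y: "y \<in> topspace X"
  shows "p0 X \<epsilon> x = p0 X \<epsilon> y \<longleftrightarrow>
    x = y \<or> x \<in> limit_space \<epsilon> \<and> y \<in> limit_space \<epsilon> \<and> e0 X \<epsilon> x = e0 X \<epsilon> y"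
proof (cases "x \<in> limit_space \<epsilon>")
  case True
  then show ?thesis
    using p0_eq_in0[OF ext True] in0_eq_p0_iff[OF ext e0_in_end_space[OF ext True] y] by auto
next
  case False
  have "x = y" if "p0 X \<epsilon> x = p0 X \<epsilon> y"
  proof -
    have "(Inl x, Inl y) \<in> C0_rel X \<epsilon>"
      using that unfolding p0_def
      by (rule eq_equiv_class[OF _ equiv_pushout_rel]) (use y in auto)
    then show ?thesis using pushout_rel_Inl[OF _ False] by blast
  qed
  then show ?thesis using False by blast
qed

lemma inj_on_p0_iff:
  assumes ext: "exterior_space X \<epsilon>"
  shows "inj_on (p0 X \<epsilon>) (topspace X) \<longleftrightarrow> inj_on (e0 X \<epsilon>) (limit_space \<epsilon>)"
proof
  assume inj: "inj_on (p0 X \<epsilon>) (topspace X)"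
  show "inj_on (e0 X \<epsilon>) (limit_space \<epsilon>)"
  proof (rule inj_onI)
    fix x y assume xy: "x \<in> limit_space \<epsilon>" "y \<in> limit_space \<epsilon>" "e0 X \<epsilon> x = e0 X \<epsilon> y"
    then have top: "x \<in> topspace X" "y \<in> topspace X"
      using limit_space_subset_topspace[OF ext] by (simp_all add: subset_iff)
    then have "p0 X \<epsilon> x = p0 X \<epsilon> y" using p0_eq_p0_iff[OF ext] xy by simp
    then show "x = y" using inj_onD[OF inj] top by simp
  qed
next
  assume inj: "inj_on (e0 X \<epsilon>) (limit_space \<epsilon>)"
  show "inj_on (p0 X \<epsilon>) (topspace X)"
  proof (rule inj_onI)
    fix x y assume "x \<in> topspace X" "y \<in> topspace X" "p0 X \<epsilon> x = p0 X \<epsilon> y"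
    then have "x = y \<or> x \<in> limit_space \<epsilon> \<and> y \<in> limit_space \<epsilon> \<and> e0 X \<epsilon> x = e0 X \<epsilon> y"
      using p0_eq_p0_iff[OF ext] by simp
    then show "x = y" using inj_onD[OF inj] by auto
  qed
qed

lemma p0_image_eq_C0_set_iff:
  assumes ext: "exterior_space X \<epsilon>"
  shows "p0 X \<epsilon> ` topspace X = C0_set X \<epsilon> \<longleftrightarrow>
    e0 X \<epsilon> ` limit_space \<epsilon> = topspace (end_space X \<epsilon>)"
proof -
  have "in0 X \<epsilon> a \<in> p0 X \<epsilon> ` topspace X \<longleftrightarrow> a \<in> e0 X \<epsilon> ` limit_space \<epsilon>"
    if "a \<in> topspace (end_space X \<epsilon>)" for a
    using in0_eq_p0_iff[OF ext that] limit_space_subset_topspace[OF ext] by blast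
  then have "in0 X \<epsilon> ` topspace (end_space X \<epsilon>) \<subseteq> p0 X \<epsilon> ` topspace X \<longleftrightarrow>
      topspace (end_space X \<epsilon>) \<subseteq> e0 X \<epsilon> ` limit_space \<epsilon>"
    unfolding image_subset_iff by (simp add: subset_eq)
  moreover have "e0 X \<epsilon> ` limit_space \<epsilon> \<subseteq> topspace (end_space X \<epsilon>)"
    using e0_in_end_space[OF ext] by (simp add: image_subset_iff)
  ultimately show ?thesis
    unfolding C0_set_eq by (metis sup.absorb_iff1 subset_antisym order_refl)
qed

lemma bij_betw_p0_iff:
  assumes "exterior_space X \<epsilon>"
  shows "bij_betw (p0 X \<epsilon>) (topspace X) (C0_set X \<epsilon>) \<longleftrightarrow>
    bij_betw (e0 X \<epsilon>) (limit_space \<epsilon>) (topspace (end_space X \<epsilon>))"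
  unfolding bij_betw_def inj_on_p0_iff[OF assms] p0_image_eq_C0_set_iff[OF assms] ..


section \<open>Isomorphisms of exterior spaces\<close>

lemma exterior_iso_iff_bij_betw:
  assumes "exterior_space X \<epsilon>"
  shows "exterior_iso X \<epsilon> Y \<delta> f \<longleftrightarrow>
    exterior_map X \<epsilon> Y \<delta> f \<and> bij_betw f (topspace X) (topspace Y) \<and>
    (\<forall>U. openin X U \<longrightarrow> openin Y (f ` U)) \<and> (\<forall>E\<in>\<epsilon>. f ` E \<in> \<delta>)"
proof -
  have preimage: "{y \<in> topspace Y. g y \<in> U} = f ` U"
    if "g \<in> topspace Y \<rightarrow> topspace X" "f \<in> topspace X \<rightarrow> topspace Y"
      "\<forall>x\<in>topspace X. g (f x) = x" "\<forall>y\<in>topspace Y. f (g y) = y" "U \<subseteq> topspace X" for g U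
    using that by (auto simp: image_iff Pi_iff) (metis subsetD)+
  have sub: "E \<subseteq> topspace X" if "E \<in> \<epsilon>" for E
    using exterior_openin[OF assms that] by (rule openin_subset)
  show ?thesis
  proof
    assume "exterior_iso X \<epsilon> Y \<delta> f"
    then obtain g where f: "exterior_map X \<epsilon> Y \<delta> f" and g: "exterior_map Y \<delta> X \<epsilon> g"
      and inv: "\<forall>x\<in>topspace X. g (f x) = x" "\<forall>y\<in>topspace Y. f (g y) = y"
      unfolding exterior_iso_def by blast
    have maps: "g \<in> topspace Y \<rightarrow> topspace X" "f \<in> topspace X \<rightarrow> topspace Y"
      using f g unfolding exterior_map_def continuous_map_def by auto
    have "bij_betw f (topspace X) (topspace Y)"
      using maps inv by (intro bij_betwI) auto
    moreover have "openin Y (f ` U)" if U: "openin X U" for U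
      using g U preimage[OF maps inv openin_subset[OF U]]
      unfolding exterior_map_def continuous_map_def by metis
    moreover have "f ` E \<in> \<delta>" if E: "E \<in> \<epsilon>" for E
      using g E preimage[OF maps inv sub[OF E]] unfolding exterior_map_def by metis
    ultimately show "exterior_map X \<epsilon> Y \<delta> f \<and> bij_betw f (topspace X) (topspace Y) \<and>
        (\<forall>U. openin X U \<longrightarrow> openin Y (f ` U)) \<and> (\<forall>E\<in>\<epsilon>. f ` E \<in> \<delta>)"
      using f by blast
  next
    assume R: "exterior_map X \<epsilon> Y \<delta> f \<and> bij_betw f (topspace X) (topspace Y) \<and>
        (\<forall>U. openin X U \<longrightarrow> openin Y (f ` U)) \<and> (\<forall>E\<in>\<epsilon>. f ` E \<in> \<delta>)"
    let ?g = "inv_into (topspace X) f"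
    have bij: "bij_betw f (topspace X) (topspace Y)" using R by blast
    have maps: "?g \<in> topspace Y \<rightarrow> topspace X" "f \<in> topspace X \<rightarrow> topspace Y"
      using bij bij_betw_inv_into[OF bij] by (auto dest: bij_betwE)
    have inv: "\<forall>x\<in>topspace X. ?g (f x) = x" "\<forall>y\<in>topspace Y. f (?g y) = y"
      using bij by (auto simp: bij_betw_inv_into_left bij_betw_inv_into_right)
    have "exterior_map Y \<delta> X \<epsilon> ?g"
      unfolding exterior_map_def continuous_map_def
    proof (intro conjI allI impI ballI maps(1))
      fix U assume U: "openin X U"
      show "openin Y {y \<in> topspace Y. ?g y \<in> U}"
        unfolding preimage[OF maps inv openin_subset[OF U]] using R U by blast
    next
      fix E assume E: "E \<in> \<epsilon>"
      show "{y \<in> topspace Y. ?g y \<in> E} \<in> \<delta>"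
        unfolding preimage[OF maps inv sub[OF E]] using R E by blast
    qed
    then show "exterior_iso X \<epsilon> Y \<delta> f"
      using R inv unfolding exterior_iso_def by blast
  qed
qed

lemma exterior_map_p0:
  assumes ext: "exterior_space X \<epsilon>"
  shows "exterior_map X \<epsilon> (C0_space X \<epsilon>) (C0_externology X \<epsilon>) (p0 X \<epsilon>)"
  unfolding exterior_map_def
proof (intro conjI ballI)
  show "continuous_map X (C0_space X \<epsilon>) (p0 X \<epsilon>)"
    unfolding continuous_map_def
    by (auto simp: topspace_C0_space[OF ext] p0_in_C0_set openin_C0_space[OF ext]
        C0_open_def Let_def)
next
  fix V assume "V \<in> C0_externology X \<epsilon>"
  then obtain E where E: "E \<in> \<epsilon>" "V = W0 X \<epsilon> E" by (auto simp: C0_externology_def)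
  moreover have "E \<subseteq> topspace X" using exterior_openin[OF ext E(1)] by (rule openin_subset)
  ultimately have "{x \<in> topspace X. p0 X \<epsilon> x \<in> V} = E"
    using p0_in_W0_iff[OF ext] by blast
  then show "{x \<in> topspace X. p0 X \<epsilon> x \<in> V} \<in> \<epsilon>" using E by simp
qed

lemma p0_image_exterior:
  assumes ext: "exterior_space X \<epsilon>"
    and surj: "e0 X \<epsilon> ` limit_space \<epsilon> = topspace (end_space X \<epsilon>)"
    and E: "E \<in> \<epsilon>"
  shows "p0 X \<epsilon> ` E = W0 X \<epsilon> E"
proof -
  have "in0 X \<epsilon> ` topspace (end_space X \<epsilon>) = p0 X \<epsilon> ` limit_space \<epsilon>"
    using p0_eq_in0[OF ext] by (simp add: image_image flip: surj)
  moreover have "limit_space \<epsilon> \<subseteq> E" using E by (auto simp: limit_space_def)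
  ultimately show ?thesis unfolding W0_def by blast
qed


section \<open>Open images and saturated neighbourhoods\<close>

text \<open>The sets \<open>q0\<close> pulls back from open sets of path-components are exactly the saturated open
  sets, so neighbourhoods may be phrased on either side.\<close>

lemma pi0_open_neighbourhood_iff_saturated:
  assumes x: "x \<in> topspace Y"
  shows "(\<exists>G. openin (pi0 Y) G \<and> q0 Y x \<in> G \<and> {y \<in> topspace Y. q0 Y y \<in> G} \<subseteq> U) \<longleftrightarrow>
    (\<exists>W. openin Y W \<and> q0_saturated Y W \<and> x \<in> W \<and> W \<subseteq> U)"
proof
  assume "\<exists>G. openin (pi0 Y) G \<and> q0 Y x \<in> G \<and> {y \<in> topspace Y. q0 Y y \<in> G} \<subseteq> U"
  then obtain G where G: "openin (pi0 Y) G" "q0 Y x \<in> G" "{y \<in> topspace Y. q0 Y y \<in> G} \<subseteq> U"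
    by blast
  let ?W = "{y \<in> topspace Y. q0 Y y \<in> G}"
  have "openin Y ?W" using G(1) by (simp add: pi0_def openin_quotient_topology)
  moreover have "q0_saturated Y ?W" by (auto simp: q0_saturated_def)
  ultimately show "\<exists>W. openin Y W \<and> q0_saturated Y W \<and> x \<in> W \<and> W \<subseteq> U"
    using G x by blast
next
  assume "\<exists>W. openin Y W \<and> q0_saturated Y W \<and> x \<in> W \<and> W \<subseteq> U"
  then obtain W where W: "openin Y W" "q0_saturated Y W" "x \<in> W" "W \<subseteq> U" by blast
  have pre: "{y \<in> topspace Y. q0 Y y \<in> q0 Y ` W} = W"
    using W(2) by (simp add: q0_saturated_def)
  have "openin (pi0 Y) (q0 Y ` W)"
    unfolding pi0_def openin_quotient_topology pre using W(1) openin_subset by blast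
  then show "\<exists>G. openin (pi0 Y) G \<and> q0 Y x \<in> G \<and> {y \<in> topspace Y. q0 Y y \<in> G} \<subseteq> U"
    using W(3,4) pre by (intro exI[of _ "q0 Y ` W"]) auto
qed

lemma openin_eta0_preimage:
  assumes "E \<in> \<epsilon>" "openin (pi0 (subtopology X E)) G"
  shows "openin (end_space X \<epsilon>) {b \<in> topspace (end_space X \<epsilon>). eta0 E b \<in> G}"
proof -
  have "continuous_map (end_space X \<epsilon>) (pi0 (subtopology X E)) (eta0 E)"
    unfolding end_space_def eta0_def[abs_def]
    by (intro continuous_map_from_subtopology continuous_map_product_projection assms(1))
  then show ?thesis using assms(2) by (rule openin_continuous_map_preimage)
qed

text \<open>When every end comes from a unique limit point, the conditions on the ends in the image of
  \<open>U\<close> all follow from the inclusion of the union of components in \<open>U\<close>: an end with component in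
  \<open>G\<close> is that of a limit point in this union, hence in \<open>U\<close>; and these basic sets of ends cover the
  trace of the image on the end space, which is therefore open.\<close>

lemma C0_open_p0_image_iff:
  assumes ext: "exterior_space X \<epsilon>"
    and bij: "bij_betw (e0 X \<epsilon>) (limit_space \<epsilon>) (topspace (end_space X \<epsilon>))"
    and U: "openin X U"
  shows "C0_open X \<epsilon> (p0 X \<epsilon> ` U) \<longleftrightarrow>
    (\<forall>x\<in>limit_space \<epsilon> \<inter> U. \<exists>E\<in>\<epsilon>. \<exists>W. openin (subtopology X E) W \<and>
       q0_saturated (subtopology X E) W \<and> x \<in> W \<and> W \<subseteq> U)"
proof -
  let ?A = "e0 X \<epsilon> ` (limit_space \<epsilon> \<inter> U)"
  have UX: "U \<subseteq> topspace X" using U by (rule openin_subset)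
  have surj: "topspace (end_space X \<epsilon>) = e0 X \<epsilon> ` limit_space \<epsilon>"
    using bij by (simp add: bij_betw_def)
  have "inj_on (p0 X \<epsilon>) (topspace X)"
    using bij inj_on_p0_iff[OF ext] by (simp add: bij_betw_def)
  then have P: "{x \<in> topspace X. p0 X \<epsilon> x \<in> p0 X \<epsilon> ` U} = U"
    using UX by (auto dest: inj_onD)
  have A: "{a \<in> topspace (end_space X \<epsilon>). in0 X \<epsilon> a \<in> p0 X \<epsilon> ` U} = ?A"
  proof (intro equalityI subsetI)
    fix a assume "a \<in> {a \<in> topspace (end_space X \<epsilon>). in0 X \<epsilon> a \<in> p0 X \<epsilon> ` U}"
    then obtain x where "a \<in> topspace (end_space X \<epsilon>)" "x \<in> U" "in0 X \<epsilon> a = p0 X \<epsilon> x"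
      by auto
    then show "a \<in> ?A"
      using in0_eq_p0_iff[OF ext, of a x] UX by auto
  next
    fix a assume "a \<in> ?A"
    then obtain x where "x \<in> limit_space \<epsilon>" "x \<in> U" "a = e0 X \<epsilon> x" by auto
    then show "a \<in> {a \<in> topspace (end_space X \<epsilon>). in0 X \<epsilon> a \<in> p0 X \<epsilon> ` U}"
      using p0_eq_in0[OF ext, of x] e0_in_end_space[OF ext, of x] by auto
  qed
  have C: "p0 X \<epsilon> ` U \<subseteq> C0_set X \<epsilon>"
    by (intro image_subsetI p0_in_C0_set) (use UX in auto)
  have lim: "x \<in> E" "eta0 E (e0 X \<epsilon> x) = q0 (subtopology X E) x"
    if "x \<in> limit_space \<epsilon>" "E \<in> \<epsilon>" for x E
    using that by (auto simp: limit_space_def eta0_def e0_def)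
  let ?N = "\<lambda>a E G. openin (pi0 (subtopology X E)) G \<and> eta0 E a \<in> G \<and>
      {b \<in> topspace (end_space X \<epsilon>). eta0 E b \<in> G} \<subseteq> ?A \<and>
      {y \<in> E. q0 (subtopology X E) y \<in> G} \<subseteq> U"
  have local: "(\<exists>G. ?N (e0 X \<epsilon> x) E G) \<longleftrightarrow> (\<exists>W. openin (subtopology X E) W \<and>
       q0_saturated (subtopology X E) W \<and> x \<in> W \<and> W \<subseteq> U)"
    if x: "x \<in> limit_space \<epsilon>" and E: "E \<in> \<epsilon>" for x E
  proof -
    have top: "topspace (subtopology X E) = E"
      by (rule topspace_exterior_subtopology[OF ext E])
    have "{b \<in> topspace (end_space X \<epsilon>). eta0 E b \<in> G} \<subseteq> ?A"
      if "{y \<in> E. q0 (subtopology X E) y \<in> G} \<subseteq> U" for G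
    proof
      fix b assume b: "b \<in> {b \<in> topspace (end_space X \<epsilon>). eta0 E b \<in> G}"
      then obtain y where y: "y \<in> limit_space \<epsilon>" "b = e0 X \<epsilon> y"
        unfolding surj by auto
      then have "y \<in> U" using b that lim[OF y(1) E] by auto
      then show "b \<in> ?A" using y by simp
    qed
    then have "(\<exists>G. ?N (e0 X \<epsilon> x) E G) \<longleftrightarrow> (\<exists>G. openin (pi0 (subtopology X E)) G \<and>
        q0 (subtopology X E) x \<in> G \<and> {y \<in> E. q0 (subtopology X E) y \<in> G} \<subseteq> U)"
      unfolding lim(2)[OF x E] by iprover
    then show ?thesis
      using pi0_open_neighbourhood_iff_saturated[of x "subtopology X E" U] lim(1)[OF x E]
      unfolding top by simp
  qed
  have "openin (end_space X \<epsilon>) ?A" if nbh: "\<forall>a\<in>?A. \<exists>E\<in>\<epsilon>. \<exists>G. ?N a E G"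
  proof (subst openin_subopen, rule ballI)
    fix a assume a: "a \<in> ?A"
    obtain E G where "E \<in> \<epsilon>" "?N a E G" using bspec[OF nbh a] by (elim bexE exE)
    moreover have "a \<in> topspace (end_space X \<epsilon>)" using a unfolding surj by auto
    ultimately show "\<exists>T. openin (end_space X \<epsilon>) T \<and> a \<in> T \<and> T \<subseteq> ?A"
      using openin_eta0_preimage[of E \<epsilon> X G]
      by (intro exI[of _ "{b \<in> topspace (end_space X \<epsilon>). eta0 E b \<in> G}"]) simp
  qed
  then have "C0_open X \<epsilon> (p0 X \<epsilon> ` U) \<longleftrightarrow> (\<forall>a\<in>?A. \<exists>E\<in>\<epsilon>. \<exists>G. ?N a E G)"
    unfolding C0_open_def Let_def P A using C U by iprover
  also have "\<dots> \<longleftrightarrow> (\<forall>x\<in>limit_space \<epsilon> \<inter> U. \<exists>E\<in>\<epsilon>. \<exists>W. openin (subtopology X E) W \<and>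
       q0_saturated (subtopology X E) W \<and> x \<in> W \<and> W \<subseteq> U)"
    by (simp add: local cong: bex_cong)
  finally show ?thesis .
qed


section \<open>The characterisation of completeness\<close>

theorem theorem3p2:
  fixes X :: "'a topology" and \<epsilon> :: "'a set set"
  assumes "exterior_space X \<epsilon>"
  shows "C0_complete X \<epsilon> \<longleftrightarrow>
    bij_betw (e0 X \<epsilon>) (limit_space \<epsilon>) (topspace (end_space X \<epsilon>)) \<and>
    (\<forall>x\<in>limit_space \<epsilon>. \<forall>U. openin X U \<and> x \<in> U \<longrightarrow>
       (\<exists>E\<in>\<epsilon>. \<exists>W. openin (subtopology X E) W \<and> q0_saturated (subtopology X E) W \<and>
          x \<in> W \<and> W \<subseteq> U))"
proof -
  let ?bij = "bij_betw (e0 X \<epsilon>) (limit_space \<epsilon>) (topspace (end_space X \<epsilon>))"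
  have "C0_complete X \<epsilon> \<longleftrightarrow> ?bij \<and> (\<forall>U. openin X U \<longrightarrow> C0_open X \<epsilon> (p0 X \<epsilon> ` U)) \<and>
      (\<forall>E\<in>\<epsilon>. p0 X \<epsilon> ` E \<in> C0_externology X \<epsilon>)"
    unfolding C0_complete_def exterior_iso_iff_bij_betw[OF assms]
      topspace_C0_space[OF assms] bij_betw_p0_iff[OF assms] openin_C0_space[OF assms]
    using exterior_map_p0[OF assms] by blast
  also have "\<dots> \<longleftrightarrow> ?bij \<and> (\<forall>U. openin X U \<longrightarrow> C0_open X \<epsilon> (p0 X \<epsilon> ` U))"
    using p0_image_exterior[OF assms] by (auto simp: bij_betw_def C0_externology_def)
  also have "\<dots> \<longleftrightarrow> ?bij \<and> (\<forall>U. openin X U \<longrightarrow>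
      (\<forall>x\<in>limit_space \<epsilon> \<inter> U. \<exists>E\<in>\<epsilon>. \<exists>W. openin (subtopology X E) W \<and>
         q0_saturated (subtopology X E) W \<and> x \<in> W \<and> W \<subseteq> U))"
    by (simp add: C0_open_p0_image_iff[OF assms] cong: conj_cong)
  also have "\<dots> \<longleftrightarrow> ?bij \<and> (\<forall>x\<in>limit_space \<epsilon>. \<forall>U. openin X U \<and> x \<in> U \<longrightarrow>
      (\<exists>E\<in>\<epsilon>. \<exists>W. openin (subtopology X E) W \<and> q0_saturated (subtopology X E) W \<and>
         x \<in> W \<and> W \<subseteq> U))"
    by blast
  finally show ?thesis .
qed

end
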